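(* Let $F$ be a field of characteristic not $2$. Let $R$ be a finitely generated associative $F$-algebra (not necessarily unital) with an idempotent $e\in R$ such that $ReR=R(1-e)R=R$. Then the Lie algebra $[R,R]$ is finitely generated.
   Context: For an associative $F$-algebra $R$, $R^{(-)}$ denotes the Lie algebra $R$ with bracket $[a,b]=ab-ba$, and $[R,R]$ is the $F$-span of all commutators $[a,b]$, $a,b\in R$, regarded as a Lie subalgebra of $R^{(-)}$. For subsets, juxtaposition denotes the $F$-span of products, so $ReR=\mathrm{span}_F\{aeb: a,b\in R\}$ and $R(1-e)R=\mathrm{span}_F\{ab-aeb: a,b\in R\}$. If $R$ is not unital, $1$ denotes the identity of the unital hull of $R$. Finitely generated means finitely generated as an $F$-algebra of the respective type. *)

theory Defs
  imports "HOL-Computational_Algebra.Computational_Algebra"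
begin

text \<open>
  An associative algebra over a field, not necessarily unital: its ring structure is that of the
  type class \<open>ring\<close>, which provides no identity element.
\<close>

locale assoc_algebra = vector_space scale
  for scale :: "'f::field \<Rightarrow> 'a::ring \<Rightarrow> 'a" (infixr \<open>*s\<close> 75) +
  assumes scale_mult_left: "c *s (x * y) = (c *s x) * y"
    and scale_mult_right: "c *s (x * y) = x * (c *s y)"

definition lie_bracket :: "'a::ring \<Rightarrow> 'a \<Rightarrow> 'a"
  where "lie_bracket a b = a * b - b * a"

context assoc_algebra
begin

text \<open>
  The bilinear product \<open>m\<close> is either the associative product or the commutator bracket, so that
  subalgebras and finite generation of associative and of Lie algebras are instances of the same
  definitions. Subalgebras of an associative algebra need not be unital.
\<close>

definition subalgebra :: "('a \<Rightarrow> 'a \<Rightarrow> 'a) \<Rightarrow> 'a set \<Rightarrow> bool"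
  where "subalgebra m S \<longleftrightarrow> subspace S \<and> (\<forall>x\<in>S. \<forall>y\<in>S. m x y \<in> S)"

definition finitely_generated :: "('a \<Rightarrow> 'a \<Rightarrow> 'a) \<Rightarrow> 'a set \<Rightarrow> bool"
  where "finitely_generated m A \<longleftrightarrow> (\<exists>X. finite X \<and> X \<subseteq> A \<and> subalgebra m hull X = A)"

abbreviation fg_assoc_algebra :: "'a set \<Rightarrow> bool"
  where "fg_assoc_algebra \<equiv> finitely_generated (*)"

abbreviation fg_lie_algebra :: "'a set \<Rightarrow> bool"
  where "fg_lie_algebra \<equiv> finitely_generated lie_bracket"

definition commutator_space :: "'a set"
  where "commutator_space = span {lie_bracket a b | a b. True}"

definition corner_ideal :: "'a \<Rightarrow> 'a set"
  where "corner_ideal e = span {a * e * b | a b. True}"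

text \<open>The product \<open>a (1 - e) b\<close> in the unital hull expands to \<open>a b - a e b\<close>.\<close>

definition co_corner_ideal :: "'a \<Rightarrow> 'a set"
  where "co_corner_ideal e = span {a * b - a * e * b | a b. True}"

lemma subalgebra_hull: "subalgebra m (subalgebra m hull X)"
  by (rule hull_in) (auto simp: subalgebra_def intro: subspace_Inter)

lemma lie_bracket_self: "lie_bracket x x = 0"
  by (simp add: lie_bracket_def)

lemma lie_bracket_jacobi:
  "lie_bracket x (lie_bracket y z) + lie_bracket y (lie_bracket z x)
     + lie_bracket z (lie_bracket x y) = 0"
  by (simp add: lie_bracket_def algebra_simps)

lemma lie_bracket_bilinear:
  "lie_bracket (x + y) z = lie_bracket x z + lie_bracket y z"
  "lie_bracket x (y + z) = lie_bracket x y + lie_bracket x z"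
  "lie_bracket (c *s x) y = c *s lie_bracket x y"
  "lie_bracket x (c *s y) = c *s lie_bracket x y"
  by (simp_all add: lie_bracket_def algebra_simps scale_right_diff_distrib
        scale_mult_left [symmetric] scale_mult_right [symmetric])

lemma subalgebra_commutator_space: "subalgebra lie_bracket commutator_space"
  unfolding subalgebra_def commutator_space_def
  by (auto intro: span_base)

end

end

theory Submission
  imports Defs
begin

text \<open>
  Let \<open>P = e R (1 - e)\<close> and \<open>Q = (1 - e) R e\<close> be the off-diagonal Peirce components. The two
  hypotheses on \<open>e\<close> say that \<open>P \<union> Q\<close> generates \<open>R\<close>, so \<open>R\<close> is generated by \<open>A \<union> B\<close> for some finite
  \<open>A \<subseteq> P\<close>, \<open>B \<subseteq> Q\<close>. As \<open>P P = Q Q = 0\<close>, double commutators yield the Jordan triple products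
  \<open>p q r + r q p\<close>, and modulo triple products of shorter words an alternating word
  \<open>x\<^sub>1 y\<^sub>1 x\<^sub>2 y\<^sub>2 x\<^sub>3\<close> changes sign when \<open>x\<^sub>1\<close> and \<open>x\<^sub>2\<close> are exchanged. A long alternating word of odd
  length contains a repeated pair of letters, hence is congruent to its own negative and vanishes
  modulo shorter words, as the characteristic is not 2. So the finitely many short alternating
  words of odd length generate a Lie algebra containing all of them, and this Lie algebra is
  \<open>[R, R]\<close> by the identity \<open>[a b, c] = [a, b c] + [b, c a]\<close>.
\<close>

section \<open>Alternating words\<close>

text \<open>The index \<open>n\<close> counts the letters from \<open>B\<close>, so the word has length \<open>2 n + 1\<close>.\<close>

inductive alternating_word :: "'a::ring set \<Rightarrow> 'a set \<Rightarrow> nat \<Rightarrow> 'a \<Rightarrow> bool" for A B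
  where
    letter: "a \<in> A \<Longrightarrow> alternating_word A B 0 a"
  | step: "a \<in> A \<Longrightarrow> b \<in> B \<Longrightarrow> alternating_word A B n w \<Longrightarrow> alternating_word A B (Suc n) (a * b * w)"

text \<open>Two cases are needed because in a ring without \<open>1\<close> a one-letter word has no
  empty cofactor.\<close>

lemma alternating_word_first:
  assumes "alternating_word A B n w"
  obtains a where "a \<in> A" "w = a"
  | a r where "a \<in> A" "w = a * r"
  using assms by cases (auto simp: mult.assoc)

text \<open>Both words begin and end in \<open>A\<close>, so the last letter of \<open>u\<close>
  meets the first letter of \<open>w\<close>.\<close>

lemma alternating_word_mult_eq_0:
  assumes "alternating_word A B n u" "alternating_word A B m w"
    and "\<And>a a'. a \<in> A \<Longrightarrow> a' \<in> A \<Longrightarrow> a * a' = 0"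
  shows "u * w = 0"
  using assms(1)
proof induction
  case (letter a)
  from assms(2) show ?case
    by (rule alternating_word_first) (use assms(3) letter in \<open>auto simp: mult.assoc [symmetric]\<close>)
qed (simp add: mult.assoc)

lemma alternating_word_snoc:
  assumes "alternating_word A B n u" "b \<in> B" "alternating_word A B m w"
  shows "alternating_word A B (Suc (n + m)) (u * b * w)"
  using assms(1)
proof induction
  case (letter a)
  with assms show ?case by (auto intro: step)
next
  case (step a b' n u)
  then have "alternating_word A B (Suc (Suc (n + m))) (a * b' * (u * b * w))"
    by (intro alternating_word.step [OF step.hyps(1,2)] step.IH)
  then show ?case by (simp add: mult.assoc)
qed

text \<open>The roles of the letter sets are swapped in \<open>v\<close>, so its index
  \<open>k\<close> counts letters from \<open>A\<close> and it has \<open>k + 1\<close> letters from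
  \<open>B\<close>. The induction moves the letters of \<open>v\<close> two at a time into
  \<open>u\<close>.\<close>

lemma alternating_word_mult3:
  assumes "alternating_word A B n u" "alternating_word B A k v" "alternating_word A B m w"
  shows "alternating_word A B (Suc (n + k + m)) (u * v * w)"
  using assms(2,1)
proof (induction arbitrary: n u)
  case (letter b)
  with assms(3) show ?case by (simp add: alternating_word_snoc)
next
  case (step b a k v)
  have "alternating_word A B (Suc (n + 0)) (u * b * a)"
    using step.hyps step.prems by (intro alternating_word_snoc alternating_word.letter)
  from step.IH [OF this] show ?case by (simp add: mult.assoc)
qed

section \<open>Finiteness and repetitions in long words\<close>

lemma finite_alternating_words:
  assumes "finite A" "finite B"
  shows "finite {w. alternating_word A B n w}"
proof (induction n)
  case 0
  have "{w. alternating_word A B 0 w} \<subseteq> A"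
    by (auto elim: alternating_word.cases)
  with assms show ?case by (auto intro: finite_subset)
next
  case (Suc n)
  have "{w. alternating_word A B (Suc n) w} \<subseteq>
      (\<lambda>(a, b, w). a * b * w) ` (A \<times> B \<times> {w. alternating_word A B n w})"
    by (auto elim!: alternating_word.cases [of A B "Suc _"] simp: image_iff) blast
  with assms Suc show ?case by (auto intro: finite_subset)
qed

text \<open>Words as lists of pairs acting from the left: in a ring without 1 the empty list has no product.\<close>

definition act_pairs :: "('a::ring \<times> 'a) list \<Rightarrow> 'a \<Rightarrow> 'a"
  where "act_pairs = foldr (\<lambda>(a, b) w. a * b * w)"

lemma act_pairs_simps [simp]:
  "act_pairs [] w = w"
  "act_pairs ((a, b) # l) w = a * b * act_pairs l w"
  "act_pairs (l @ l') w = act_pairs l (act_pairs l' w)"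
  by (simp_all add: act_pairs_def)

lemma alternating_word_act_pairs:
  assumes "set l \<subseteq> A \<times> B" "alternating_word A B n w"
  shows "alternating_word A B (length l + n) (act_pairs l w)"
  using assms by (induction l) (auto intro: step)

lemma alternating_word_pairsE:
  assumes "alternating_word A B n w"
  obtains l t where "length l = n" "set l \<subseteq> A \<times> B" "t \<in> A" "w = act_pairs l t"
proof -
  from assms have "\<exists>l t. length l = n \<and> set l \<subseteq> A \<times> B \<and> t \<in> A \<and> w = act_pairs l t"
  proof induction
    case (letter a)
    then show ?case by (intro exI [of _ "[]"] exI [of _ a]) simp
  next
    case (step a b n w)
    then obtain l t where "length l = n" "set l \<subseteq> A \<times> B" "t \<in> A" "w = act_pairs l t" by blast
    with step.hyps show ?case by (intro exI [of _ "(a, b) # l"] exI [of _ t]) simp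
  qed
  with that show thesis by blast
qed

text \<open>Shifting the pairing by one letter: \<open>b\<close> followed by the letters of
  \<open>l\<close> is a word that begins and ends in \<open>B\<close>, independent of
  \<open>t\<close>.\<close>

lemma left_mult_act_pairs:
  assumes "set l \<subseteq> A \<times> B" "b \<in> B"
  obtains v where "alternating_word B A (length l) v" "\<And>t. b * act_pairs l t = v * t"
proof -
  from assms have "\<exists>v. alternating_word B A (length l) v \<and> (\<forall>t. b * act_pairs l t = v * t)"
  proof (induction l arbitrary: b)
    case Nil
    then show ?case by (auto intro: letter)
  next
    case (Cons p l)
    obtain a b' where p: "p = (a, b')" by fastforce
    with Cons obtain v
      where "alternating_word B A (length l) v" "\<forall>t. b' * act_pairs l t = v * t" by fastforce
    moreover from this have "alternating_word B A (length (p # l)) (b * a * v)"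
      using p Cons.prems by (auto intro: step)
    ultimately show ?case
      using p by (intro exI [of _ "b * a * v"]) (simp add: mult.assoc)
  qed
  with that show thesis by blast
qed

text \<open>By the pigeonhole principle some pair \<open>(x, y)\<close> occurs twice. The second
  case is the one in which a nonempty prefix \<open>z * u\<close> precedes its first
  occurrence.\<close>

lemma long_alternating_word_decomp:
  assumes "finite A" "finite B" "alternating_word A B n w" "card A * card B < n"
  obtains x y k v m t where "x \<in> A" "y \<in> B" "alternating_word B A k v" "alternating_word A B m t"
    and "n = Suc (Suc (k + m))" "w = x * v * x * y * t"
  | x y z j u k v m t where "x \<in> A" "y \<in> B" "z \<in> A" "alternating_word B A j u"
    and "alternating_word B A k v" "alternating_word A B m t"
    and "n = Suc (Suc (Suc (j + k + m)))" "w = z * u * x * v * x * y * t"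
proof -
  from assms(3) obtain l t where l: "length l = n" "set l \<subseteq> A \<times> B" "t \<in> A" "w = act_pairs l t"
    by (rule alternating_word_pairsE)
  have "\<not> distinct l"
  proof
    assume "distinct l"
    then have "n = card (set l)" using l by (simp add: distinct_card)
    also have "\<dots> \<le> card (A \<times> B)" using l assms by (intro card_mono) auto
    finally show False using assms by (simp add: card_cartesian_product)
  qed
  then obtain l1 l2 l3 p where ll: "l = l1 @ [p] @ l2 @ [p] @ l3" by (metis not_distinct_decomp)
  obtain x y where p: "p = (x, y)" by fastforce
  define t' where "t' = act_pairs l3 t"
  have xy: "x \<in> A" "y \<in> B" and sub: "set l1 \<subseteq> A \<times> B" "set l2 \<subseteq> A \<times> B" "set l3 \<subseteq> A \<times> B"
    using l ll p by auto
  have t': "alternating_word A B (length l3) t'"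
    unfolding t'_def
    using alternating_word_act_pairs [OF sub(3) alternating_word.letter [OF l(3)]] by simp
  \<comment> \<open>The \<open>y\<close> of the first copy becomes the first letter of
    \<open>v\<close>; only that of the second copy stays separate.\<close>
  from left_mult_act_pairs [OF sub(2) xy(2)] obtain v
    where v: "alternating_word B A (length l2) v" "\<And>t. y * act_pairs l2 t = v * t" by blast
  have w: "w = act_pairs l1 (x * v * x * y * t')"
    using l(4) ll p v(2) by (simp add: mult.assoc t'_def)
  show thesis
  proof (cases l1)
    case Nil
    then show ?thesis
      using that(1) [OF xy v(1) t'] w l(1) ll by simp
  next
    case (Cons q l1')
    obtain z y' where q: "q = (z, y')" by fastforce
    have "set l1' \<subseteq> A \<times> B" "y' \<in> B" "z \<in> A" using sub Cons q by auto
    from left_mult_act_pairs [OF this(1,2)] obtain u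
      where "alternating_word B A (length l1') u" "\<And>t. y' * act_pairs l1' t = u * t" by blast
    with \<open>z \<in> A\<close> show ?thesis
      using that(2) [OF xy \<open>z \<in> A\<close> _ v(1) t'] w l(1) ll Cons q by (simp add: mult.assoc)
  qed
qed

text \<open>The other two terms of the double commutator, \<open>q p r\<close> and
  \<open>r p q\<close>, contain \<open>p r\<close> or \<open>r p\<close>.\<close>

lemma lie_bracket_lie_bracket_eq_triple:
  fixes p q r :: "'a::ring"
  assumes "p * r = 0" "r * p = 0"
  shows "lie_bracket (lie_bracket p q) r = p * q * r + r * q * p"
proof -
  have "q * p * r = 0" "r * (p * q) = 0"
    using assms by (simp_all add: mult.assoc) (simp add: assms mult.assoc [symmetric])
  then show ?thesis by (simp add: lie_bracket_def algebra_simps)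
qed

section \<open>Short alternating words generate the others\<close>

context assoc_algebra
begin

text \<open>Here the characteristic enters: \<open>2\<close> is invertible in the field.\<close>

lemma subspace_double_cancel:
  assumes "CHAR('f) \<noteq> 2" "subspace S" "w + w \<in> S"
  shows "w \<in> S"
proof -
  have "(2::'f) \<noteq> 0"
  proof
    assume "(2::'f) = 0"
    then have "of_nat 2 = (0::'f)" by simp
    then have "CHAR('f) dvd 2" by (simp only: of_nat_eq_0_iff_char_dvd)
    then have "CHAR('f) = 1 \<or> CHAR('f) = 2" by (metis prime_nat_iff two_is_prime_nat)
    with assms(1) show False by simp
  qed
  have "w = inverse 2 *s (2 *s w)" using \<open>(2::'f) \<noteq> 0\<close> by simp
  also have "2 *s w = w + w" using scale_left_distrib [of 1 1 w] by simp
  finally show ?thesis using subspace_scale [OF assms(2,3)] by metis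
qed

lemma long_alternating_word_mem:
  assumes char: "CHAR('f) \<noteq> 2" and L: "subalgebra lie_bracket L"
    and fin: "finite A" "finite B"
    and zero: "\<And>a a'. a \<in> A \<Longrightarrow> a' \<in> A \<Longrightarrow> a * a' = 0"
    and shorter_A: "\<And>m u. m < n \<Longrightarrow> alternating_word A B m u \<Longrightarrow> u \<in> L"
    and shorter_B: "\<And>m u. m < n \<Longrightarrow> alternating_word B A m u \<Longrightarrow> u \<in> L"
    and w: "alternating_word A B n w" and long: "card A * card B < n"
  shows "w \<in> L"
proof -
  have sub: "subspace L" and lie: "\<And>x y. x \<in> L \<Longrightarrow> y \<in> L \<Longrightarrow> lie_bracket x y \<in> L"
    using L by (auto simp: subalgebra_def)
  \<comment> \<open>The middle factor contributes one more letter from \<open>B\<close> than its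
    index \<open>j\<close>, so all three indices are below \<open>n\<close> and the factors already
    lie in \<open>L\<close>.\<close>
  have triple: "p * q * r + r * q * p \<in> L"
    if "alternating_word A B i p" "alternating_word B A j q" "alternating_word A B k r"
      and "Suc (i + j + k) = n" for i j k p q r
  proof -
    have "p \<in> L" "r \<in> L" "q \<in> L"
      using that shorter_A shorter_B by (metis less_Suc_eq_le le_add1 le_add2 add.assoc add.commute)+
    moreover have "p * r = 0" "r * p = 0"
      using alternating_word_mult_eq_0 zero that by blast+
    ultimately show ?thesis
      using lie [OF lie] by (metis lie_bracket_lie_bracket_eq_triple)
  qed
  have swap: "x1 * y1 * x2 * y2 * x3 + x2 * y1 * x1 * y2 * x3 \<in> L"
    if "alternating_word A B i1 x1" "alternating_word B A j1 y1" "alternating_word A B i2 x2"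
      "alternating_word B A j2 y2" "alternating_word A B i3 x3"
      and n: "Suc (Suc (i1 + i2 + i3 + j1 + j2)) = n" for i1 i2 i3 j1 j2 x1 x2 x3 y1 y2
  proof -
    \<comment> \<open>Modulo \<open>L\<close>, a triple product says that reversing the order of
      three blocks changes the sign. Three such reversals lead from the first word to the second,
      through \<open>x3 y1 x2 y2 x1\<close> and \<open>x1 y2 x3 y1 x2\<close>; their number is odd,
      whence the minus sign.\<close>
    have "x1 * y1 * x2 * y2 * x3 + x2 * y1 * x1 * y2 * x3 =
      (x1 * (y1 * x2 * y2) * x3 + x3 * (y1 * x2 * y2) * x1)
        - ((x3 * y1 * x2) * y2 * x1 + x1 * y2 * (x3 * y1 * x2))
        + ((x1 * y2 * x3) * y1 * x2 + x2 * y1 * (x1 * y2 * x3))"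
      by (simp add: mult.assoc)
    also have "\<dots> \<in> L"
      using that
      by (intro subspace_add subspace_diff sub
          triple [OF _ alternating_word_mult3] triple [OF alternating_word_mult3])
        (assumption | simp)+
    finally show ?thesis .
  qed
  \<comment> \<open>Exchanging the two equal letters \<open>x\<close> puts twice the word into
    \<open>L\<close>.\<close>
  have repeat: "x * v * x * y * t \<in> L"
    if "x \<in> A" "y \<in> B" "alternating_word B A k v" "alternating_word A B m t"
      "n = Suc (Suc (k + m))" for x y k v m t
    using swap [of 0 x k v 0 x 0 y m t] that char sub
    by (auto intro: subspace_double_cancel alternating_word.letter)
  from fin w long show ?thesis
  proof (cases rule: long_alternating_word_decomp)
    case 1
    with repeat show ?thesis by simp
  next
    case (2 x y z j u k v m t)
    \<comment> \<open>The prefix is glued to the first \<open>x\<close>, and the block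
      \<open>z u x\<close> is exchanged with the second \<open>x\<close>. The resulting word begins
      with \<open>x\<close> and repeats it after \<open>v z u\<close>, so \<open>repeat\<close>
      applies.\<close>
    have "alternating_word A B (Suc j) (z * u * x)"
      using alternating_word_mult3 [of A B 0 z j u 0 x] 2 by (simp add: alternating_word.letter)
    then have "(z * u * x) * v * x * y * t + x * v * (z * u * x) * y * t \<in> L"
      using 2 by (intro swap [of "Suc j" _ k _ 0 _ 0 _ m]) (simp_all add: alternating_word.letter)
    moreover have "x * (v * z * u) * x * y * t \<in> L"
      using 2 alternating_word_mult3 [of B A k v 0 z j u]
      by (intro repeat [of _ _ "Suc (k + j)" _ m]) (simp_all add: alternating_word.letter)
    ultimately show ?thesis
      using subspace_diff [OF sub] 2 by (fastforce simp: mult.assoc)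
  qed
qed

text \<open>Both kinds of words go through one induction, since the middle factor of a triple
  product is of the other kind.\<close>

lemma alternating_words_mem:
  assumes char: "CHAR('f) \<noteq> 2" and L: "subalgebra lie_bracket L"
    and fin: "finite A" "finite B"
    and zero_A: "\<And>a a'. a \<in> A \<Longrightarrow> a' \<in> A \<Longrightarrow> a * a' = 0"
    and zero_B: "\<And>b b'. b \<in> B \<Longrightarrow> b' \<in> B \<Longrightarrow> b * b' = 0"
    and short: "\<And>n w. n \<le> card A * card B \<Longrightarrow>
      alternating_word A B n w \<or> alternating_word B A n w \<Longrightarrow> w \<in> L"
    and "alternating_word A B n w \<or> alternating_word B A n w"
  shows "w \<in> L"
  using assms(8)
proof (induction n arbitrary: w rule: less_induct)
  case (less n)
  show ?case
  proof (cases "n \<le> card A * card B")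
    case False
    \<comment> \<open>The bound is symmetric in \<open>A\<close> and \<open>B\<close>, so the
      previous lemma applies in both orientations.\<close>
    then have "card A * card B < n" "card B * card A < n" by (auto simp: mult.commute)
    with less long_alternating_word_mem [OF char L fin zero_A]
      long_alternating_word_mem [OF char L fin(2,1) zero_B] show ?thesis by metis
  qed (use short less.prems in blast)
qed

section \<open>Commutators\<close>

text \<open>The identity for \<open>[a b, c]\<close> makes the elements whose brackets with all of
  \<open>R\<close> lie in \<open>L\<close> an associative subalgebra, so checking generators is
  enough.\<close>

lemma commutator_space_subset:
  assumes L: "subspace L" and gen: "subalgebra (*) hull Z = UNIV"
    and "\<And>z r. z \<in> Z \<Longrightarrow> lie_bracket z r \<in> L"
  shows "commutator_space \<subseteq> L"
proof -
  have "lie_bracket (a * b) c = lie_bracket a (b * c) + lie_bracket b (c * a)" for a b c :: 'a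
    by (simp add: lie_bracket_def mult.assoc)
  then have "subalgebra (*) {r. \<forall>s. lie_bracket r s \<in> L}"
    using L
    by (auto simp: subalgebra_def subspace_def lie_bracket_bilinear) (simp add: lie_bracket_def)
  moreover have "Z \<subseteq> {r. \<forall>s. lie_bracket r s \<in> L}" using assms(3) by auto
  ultimately have "subalgebra (*) hull Z \<subseteq> {r. \<forall>s. lie_bracket r s \<in> L}"
    by (intro hull_minimal)
  with gen L show ?thesis
    unfolding commutator_space_def by (intro span_minimal) auto
qed

lemma span_left_ideal_UNIV:
  assumes gen: "subalgebra (*) hull Z = UNIV" and "Z \<subseteq> U"
    and "\<And>z u. z \<in> Z \<Longrightarrow> u \<in> U \<Longrightarrow> z * u \<in> span U"
  shows "span U = UNIV"
proof -
  \<comment> \<open>Without \<open>1\<close>, membership of \<open>r\<close> in the span does not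
    follow from \<open>r\<close> mapping the span into itself, so \<open>?T\<close> demands
    both.\<close>
  let ?T = "{r \<in> span U. \<forall>s \<in> span U. r * s \<in> span U}"
  have "subalgebra (*) ?T"
    by (auto simp: subalgebra_def subspace_def distrib_right mult.assoc scale_mult_left [symmetric]
        intro: span_zero span_add span_scale)
  moreover have "z * s \<in> span U" if "z \<in> Z" "s \<in> span U" for z s
    using that(2)
  proof (induction rule: span_induct_alt)
    case (step c u s)
    then show ?case
      using assms(3) [OF that(1)]
      by (auto simp: distrib_left scale_mult_right [symmetric] intro: span_add span_scale)
  qed (simp add: span_zero)
  ultimately have "subalgebra (*) hull Z \<subseteq> ?T"
    using \<open>Z \<subseteq> U\<close> by (intro hull_minimal) (auto intro: span_base)
  with gen show ?thesis by auto
qed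

text \<open>Alternating words of all lengths span \<open>R\<close>. A generator brackets to zero
  with an odd word of its own kind, into \<open>L\<close> with one of the other kind, and to a
  single odd word up to sign, or zero, with an even word.\<close>

lemma commutator_space_subset_alternating:
  assumes L: "subalgebra lie_bracket L" and gen: "subalgebra (*) hull (A \<union> B) = UNIV"
    and zero_A: "\<And>a a'. a \<in> A \<Longrightarrow> a' \<in> A \<Longrightarrow> a * a' = 0"
    and zero_B: "\<And>b b'. b \<in> B \<Longrightarrow> b' \<in> B \<Longrightarrow> b * b' = 0"
    and words: "\<And>n w. alternating_word A B n w \<or> alternating_word B A n w \<Longrightarrow> w \<in> L"
  shows "commutator_space \<subseteq> L"
proof -
  have sub: "subspace L" and lie: "\<And>x y. x \<in> L \<Longrightarrow> y \<in> L \<Longrightarrow> lie_bracket x y \<in> L"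
    using L by (auto simp: subalgebra_def)
  define P where "P = {w. \<exists>n. alternating_word A B n w}"
  define Q where "Q = {w. \<exists>n. alternating_word B A n w}"
  \<comment> \<open>The products \<open>p * q\<close> and \<open>q * p\<close> are the alternating
    words of even length.\<close>
  define U where "U = P \<union> Q \<union> {p * q | p q. p \<in> P \<and> q \<in> Q} \<union> {q * p | p q. p \<in> P \<and> q \<in> Q}"
  have AP: "A \<subseteq> P" and BQ: "B \<subseteq> Q"
    by (auto simp: P_def Q_def intro: letter)
  have PL: "P \<subseteq> L" and QL: "Q \<subseteq> L" using words by (auto simp: P_def Q_def)
  have PP: "p * p' = 0" if "p \<in> P" "p' \<in> P" for p p'
    using that alternating_word_mult_eq_0 [OF _ _ zero_A] by (auto simp: P_def)
  have QQ: "q * q' = 0" if "q \<in> Q" "q' \<in> Q" for q q'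
    using that alternating_word_mult_eq_0 [OF _ _ zero_B] by (auto simp: Q_def)
  have PQP: "p * q * p' \<in> P" if "p \<in> P" "q \<in> Q" "p' \<in> P" for p q p'
    using that alternating_word_mult3 unfolding P_def Q_def by blast
  have QPQ: "q * p * q' \<in> Q" if "q \<in> Q" "p \<in> P" "q' \<in> Q" for q p q'
    using that alternating_word_mult3 unfolding P_def Q_def by blast
  have PPX: "p * (p' * r) = 0" if "p \<in> P" "p' \<in> P" for p p' r
    using PP [OF that] by (simp add: mult.assoc [symmetric])
  have QQX: "q * (q' * r) = 0" if "q \<in> Q" "q' \<in> Q" for q q' r
    using QQ [OF that] by (simp add: mult.assoc [symmetric])
  note zeros = PP QQ PPX QQX
  have U_sub: "P \<subseteq> U" "Q \<subseteq> U"
    and U_mult: "\<And>p q. p \<in> P \<Longrightarrow> q \<in> Q \<Longrightarrow> p * q \<in> U" "\<And>p q. p \<in> P \<Longrightarrow> q \<in> Q \<Longrightarrow> q * p \<in> U"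
    unfolding U_def by blast+
  have U_cases: thesis
    if "u \<in> U" "u \<in> P \<Longrightarrow> thesis" "u \<in> Q \<Longrightarrow> thesis"
      "\<And>p q. u = p * q \<Longrightarrow> p \<in> P \<Longrightarrow> q \<in> Q \<Longrightarrow> thesis"
      "\<And>p q. u = q * p \<Longrightarrow> p \<in> P \<Longrightarrow> q \<in> Q \<Longrightarrow> thesis" for u thesis
    using that unfolding U_def by auto
  \<comment> \<open>Zero is adjoined because products of words of the same kind vanish, while
    \<open>0\<close> need not be in \<open>U\<close>.\<close>
  have P_left: "p * u \<in> U \<union> {0}" if p: "p \<in> P" and "u \<in> U" for p u
  proof (rule U_cases [OF that(2)])
    fix p' q assume u: "u = q * p'" "p' \<in> P" "q \<in> Q"
    have "p * q * p' \<in> P" using p u(2,3) by (intro PQP)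
    with u(1) U_sub show ?thesis by (auto simp: mult.assoc)
  next
    fix p' q assume "u = p' * q" "p' \<in> P"
    with p show ?thesis by (simp add: PPX)
  next
    assume "u \<in> P"
    with p show ?thesis by (simp add: PP)
  next
    assume "u \<in> Q"
    with p show ?thesis by (simp add: U_mult)
  qed
  have Q_left: "q * u \<in> U \<union> {0}" if q: "q \<in> Q" and "u \<in> U" for q u
  proof (rule U_cases [OF that(2)])
    fix p q' assume u: "u = p * q'" "p \<in> P" "q' \<in> Q"
    have "q * p * q' \<in> Q" using q u(2,3) by (intro QPQ)
    with u(1) U_sub show ?thesis by (auto simp: mult.assoc)
  next
    fix p q' assume "u = q' * p" "q' \<in> Q"
    with q show ?thesis by (simp add: QQX)
  next
    assume "u \<in> Q"
    with q show ?thesis by (simp add: QQ)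
  next
    assume "u \<in> P"
    with q show ?thesis by (simp add: U_mult)
  qed
  have UNIV: "span U = UNIV"
  proof (rule span_left_ideal_UNIV [OF gen])
    show "A \<union> B \<subseteq> U" using AP BQ U_sub by blast
    fix z u assume "z \<in> A \<union> B" "u \<in> U"
    then have "z * u \<in> U \<union> {0}" using AP BQ P_left Q_left by blast
    then show "z * u \<in> span U" by (auto intro: span_base span_zero)
  qed
  have P_lie: "lie_bracket p u \<in> L" if p: "p \<in> P" and "u \<in> U" for p u
  proof (rule U_cases [OF that(2)])
    fix p' q assume u: "u = p' * q" "p' \<in> P" "q \<in> Q"
    with p have "lie_bracket p u = - (p' * q * p)" by (simp add: lie_bracket_def zeros)
    moreover have "p' * q * p \<in> L" using PL PQP u p by blast
    ultimately show ?thesis using subspace_neg [OF sub] by simp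
  next
    fix p' q assume u: "u = q * p'" "p' \<in> P" "q \<in> Q"
    with p have "lie_bracket p u = p * q * p'" by (simp add: lie_bracket_def zeros mult.assoc)
    moreover have "p * q * p' \<in> L" using PL PQP u p by blast
    ultimately show ?thesis by simp
  next
    assume "u \<in> P"
    with p sub show ?thesis by (simp add: lie_bracket_def zeros subspace_0)
  next
    assume "u \<in> Q"
    with p PL QL show ?thesis by (auto intro: lie)
  qed
  have Q_lie: "lie_bracket q u \<in> L" if q: "q \<in> Q" and "u \<in> U" for q u
  proof (rule U_cases [OF that(2)])
    fix p q' assume u: "u = q' * p" "p \<in> P" "q' \<in> Q"
    with q have "lie_bracket q u = - (q' * p * q)" by (simp add: lie_bracket_def zeros)
    moreover have "q' * p * q \<in> L" using QL QPQ u q by blast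
    ultimately show ?thesis using subspace_neg [OF sub] by simp
  next
    fix p q' assume u: "u = p * q'" "p \<in> P" "q' \<in> Q"
    with q have "lie_bracket q u = q * p * q'" by (simp add: lie_bracket_def zeros mult.assoc)
    moreover have "q * p * q' \<in> L" using QL QPQ u q by blast
    ultimately show ?thesis by simp
  next
    assume "u \<in> Q"
    with q sub show ?thesis by (simp add: lie_bracket_def zeros subspace_0)
  next
    assume "u \<in> P"
    with q PL QL show ?thesis by (auto intro: lie)
  qed
  show ?thesis
  proof (rule commutator_space_subset [OF sub gen])
    fix z r assume z: "z \<in> A \<union> B"
    have "r \<in> span U" using UNIV by simp
    then show "lie_bracket z r \<in> L"
    proof (induction rule: span_induct_alt)
      case (step c u s)
      have "lie_bracket z u \<in> L" using z step.hyps AP BQ P_lie Q_lie by blast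
      with step sub show ?case
        by (auto simp: lie_bracket_bilinear intro: subspace_add subspace_scale)
    qed (use sub in \<open>simp add: lie_bracket_def subspace_0\<close>)
  qed
qed

section \<open>Generators in the off-diagonal Peirce components\<close>

text \<open>The hulls of finite subsets of \<open>Z\<close> form a directed family, so their union
  \<open>?T\<close> is a subalgebra containing \<open>Z\<close>. Each of the finitely many given
  generators thus needs only finitely many elements of \<open>Z\<close>.\<close>

lemma finitely_generated_finite_subset:
  assumes "finitely_generated m A" "subalgebra m hull Z = A"
  obtains Z' where "finite Z'" "Z' \<subseteq> Z" "subalgebra m hull Z' = A"
proof -
  from assms(1) obtain X where X: "finite X" "X \<subseteq> A" "subalgebra m hull X = A"
    by (auto simp: finitely_generated_def)
  let ?T = "{r. \<exists>Z'. finite Z' \<and> Z' \<subseteq> Z \<and> r \<in> subalgebra m hull Z'}"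
  have hull: "subspace (subalgebra m hull Z')"
    "x \<in> subalgebra m hull Z' \<Longrightarrow> y \<in> subalgebra m hull Z' \<Longrightarrow> m x y \<in> subalgebra m hull Z'"
    for Z' x y
    using subalgebra_hull [of m Z'] by (auto simp: subalgebra_def)
  have join: "\<exists>Z'. finite Z' \<and> Z' \<subseteq> Z \<and> x \<in> subalgebra m hull Z' \<and> y \<in> subalgebra m hull Z'"
    if "x \<in> ?T" "y \<in> ?T" for x y
  proof -
    from that obtain Z1 Z2 where Z: "finite Z1" "Z1 \<subseteq> Z" "x \<in> subalgebra m hull Z1"
      "finite Z2" "Z2 \<subseteq> Z" "y \<in> subalgebra m hull Z2" by blast
    then have "x \<in> subalgebra m hull (Z1 \<union> Z2)" "y \<in> subalgebra m hull (Z1 \<union> Z2)"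
      using hull_mono [of Z1 "Z1 \<union> Z2" "subalgebra m"] hull_mono [of Z2 "Z1 \<union> Z2" "subalgebra m"]
      by auto
    with Z show ?thesis by (intro exI [of _ "Z1 \<union> Z2"]) simp
  qed
  have "subspace ?T"
  proof (rule subspaceI)
    show "0 \<in> ?T" using hull(1) subspace_0 by blast
  next
    fix x y assume "x \<in> ?T" "y \<in> ?T"
    from join [OF this] show "x + y \<in> ?T" using hull(1) subspace_add by blast
  next
    fix x c assume "x \<in> ?T"
    then show "c *s x \<in> ?T" using hull(1) subspace_scale by blast
  qed
  moreover have "m x y \<in> ?T" if "x \<in> ?T" "y \<in> ?T" for x y
    using join [OF that] hull(2) by blast
  ultimately have "subalgebra m ?T" by (simp add: subalgebra_def [of m ?T])
  moreover have "Z \<subseteq> ?T"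
  proof (rule subsetI)
    fix z assume "z \<in> Z"
    then show "z \<in> ?T" by (auto intro!: exI [of _ "{z}"] hull_inc)
  qed
  ultimately have "subalgebra m hull Z \<subseteq> ?T" by (intro hull_minimal)
  with X assms(2) have "\<forall>x\<in>X. \<exists>Z'. finite Z' \<and> Z' \<subseteq> Z \<and> x \<in> subalgebra m hull Z'" by blast
  then obtain f where f: "\<And>x. x \<in> X \<Longrightarrow> finite (f x) \<and> f x \<subseteq> Z \<and> x \<in> subalgebra m hull (f x)"
    by metis
  let ?Z = "\<Union>(f ` X)"
  have "x \<in> subalgebra m hull ?Z" if "x \<in> X" for x
    using f [OF that] hull_mono [of "f x" ?Z "subalgebra m"] that by blast
  then have "subalgebra m hull X \<subseteq> subalgebra m hull ?Z"
    by (intro hull_minimal subalgebra_hull) blast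
  moreover have "subalgebra m hull ?Z \<subseteq> A"
    using f assms(2) hull_mono [of ?Z Z "subalgebra m"] by blast
  ultimately show thesis
    using that [of ?Z] f X by blast
qed

text \<open>For idempotent \<open>e\<close> this is \<open>e R (1 - e)\<close>, written as equations
  because the ring has no \<open>1\<close>; \<open>peirce01\<close> encodes
  \<open>(1 - e) R e\<close> in the same way.\<close>

definition peirce10 :: "'a \<Rightarrow> 'a set"
  where "peirce10 e = {x. e * x = x \<and> x * e = 0}"

definition peirce01 :: "'a \<Rightarrow> 'a set"
  where "peirce01 e = {x. e * x = 0 \<and> x * e = x}"

text \<open>\<open>x y = x (e y) = (x e) y = 0\<close>.\<close>

lemma peirce10_mult_eq_0: "x \<in> peirce10 e \<Longrightarrow> y \<in> peirce10 e \<Longrightarrow> x * y = 0"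
  unfolding peirce10_def by (metis (mono_tags) mem_Collect_eq mult.assoc mult_zero_left)

lemma peirce01_mult_eq_0: "x \<in> peirce01 e \<Longrightarrow> y \<in> peirce01 e \<Longrightarrow> x * y = 0"
  unfolding peirce01_def by (metis (mono_tags) mem_Collect_eq mult.assoc mult_zero_right)

lemma alternating_word_peirce10:
  assumes "alternating_word A B n w" "A \<subseteq> peirce10 e"
  shows "w \<in> peirce10 e"
  using assms(1) by induction (use assms(2) in \<open>auto simp: peirce10_def mult.assoc [symmetric]\<close>,
      simp add: mult.assoc)

lemma alternating_word_peirce01:
  assumes "alternating_word B A n w" "B \<subseteq> peirce01 e"
  shows "w \<in> peirce01 e"
  using assms(1) by induction (use assms(2) in \<open>auto simp: peirce01_def mult.assoc [symmetric]\<close>,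
      simp add: mult.assoc)

text \<open>This keeps the Lie algebra generated by the short words inside
  \<open>[R, R]\<close>.\<close>

lemma peirce_subset_commutator_space: "peirce10 e \<union> peirce01 e \<subseteq> commutator_space"
proof
  fix x assume "x \<in> peirce10 e \<union> peirce01 e"
  then have "x = lie_bracket e x \<or> x = lie_bracket x e"
    by (auto simp: peirce10_def peirce01_def lie_bracket_def)
  then show "x \<in> commutator_space"
    unfolding commutator_space_def by (auto intro!: span_base)
qed

text \<open>From \<open>R (1 - e) R = R\<close> it follows that \<open>e R e\<close> is spanned by
  products in \<open>P Q\<close>, and from \<open>R e R = R\<close> that
  \<open>(1 - e) R (1 - e)\<close> is spanned by products in \<open>Q P\<close>. The Peirce
  decomposition then gives all of \<open>R\<close>.\<close>

lemma peirce_generate: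
  assumes e: "e * e = e" and corner: "corner_ideal e = UNIV" "co_corner_ideal e = UNIV"
  shows "subalgebra (*) hull (peirce10 e \<union> peirce01 e) = UNIV"
proof -
  let ?H = "subalgebra (*) hull (peirce10 e \<union> peirce01 e)"
  have sub: "subspace ?H" and mult: "\<And>x y. x \<in> ?H \<Longrightarrow> y \<in> ?H \<Longrightarrow> x * y \<in> ?H"
    using subalgebra_hull [of "(*)"] by (auto simp: subalgebra_def)
  have ee: "e * (e * x) = e * x" for x by (simp add: e mult.assoc [symmetric])
  have H10: "e * x - e * x * e \<in> ?H" and H01: "x * e - e * x * e \<in> ?H" for x
    by (rule hull_inc; simp add: peirce10_def peirce01_def algebra_simps e ee)+
  have "e * r * e \<in> ?H" for r
  proof -
    have "r \<in> span {a * b - a * e * b | a b. True}"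
      using corner by (auto simp: co_corner_ideal_def)
    then show ?thesis
    proof (induction rule: span_induct_alt)
      case (step c u s)
      then obtain a b where u: "u = a * b - a * e * b" by blast
      \<comment> \<open>With \<open>u = a (1 - e) b\<close>, idempotence of \<open>1 - e\<close>
        splits \<open>e u e\<close> into a factor from \<open>P\<close> and one from
        \<open>Q\<close>.\<close>
      have "e * u * e = (e * a - e * a * e) * (b * e - e * b * e)"
        unfolding u by (simp add: algebra_simps e ee)
      also have "\<dots> \<in> ?H" by (intro mult H10 H01)
      finally have "c *s (e * u * e) + e * s * e \<in> ?H"
        using step.IH sub by (intro subspace_add subspace_scale)
      then show ?case
        by (simp add: distrib_left distrib_right scale_mult_left [symmetric]
            scale_mult_right [symmetric])
    qed (simp add: subspace_0 [OF sub])
  qed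
  \<comment> \<open>This expression is \<open>(1 - e) r (1 - e)\<close> multiplied out.\<close>
  moreover have "r - e * r - r * e + e * r * e \<in> ?H" for r
  proof -
    have "r \<in> span {a * e * b | a b. True}"
      using corner by (auto simp: corner_ideal_def)
    then show ?thesis
    proof (induction rule: span_induct_alt)
      case (step c u s)
      then obtain a b where u: "u = a * e * b" by blast
      have "u - e * u - u * e + e * u * e = (a * e - e * a * e) * (e * b - e * b * e)"
        unfolding u by (simp add: algebra_simps e ee)
      also have "\<dots> \<in> ?H" by (intro mult H10 H01)
      finally have "c *s (u - e * u - u * e + e * u * e) + (s - e * s - s * e + e * s * e) \<in> ?H"
        by (intro subspace_add [OF sub _ step.IH] subspace_scale sub)
      then show ?case
        by (simp add: algebra_simps scale_right_diff_distrib scale_right_distrib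
            scale_mult_left [symmetric] scale_mult_right [symmetric])
    qed (simp add: subspace_0 [OF sub])
  qed
  ultimately have "(e * r * e + (r - e * r - r * e + e * r * e))
      + ((e * r - e * r * e) + (r * e - e * r * e)) \<in> ?H" for r
    using subspace_add [OF sub] H10 H01 by presburger
  moreover have "(e * r * e + (r - e * r - r * e + e * r * e))
      + ((e * r - e * r * e) + (r * e - e * r * e)) = r" for r
    by simp
  ultimately show ?thesis by auto
qed

end

theorem theorem1:
  fixes scale :: "'f::field \<Rightarrow> 'a::ring \<Rightarrow> 'a"
    and e :: 'a
  assumes "CHAR('f) \<noteq> 2"
    and "assoc_algebra scale"
    and "assoc_algebra.fg_assoc_algebra scale (UNIV :: 'a set)"
    and "e * e = e"
    and "assoc_algebra.corner_ideal scale e = (UNIV :: 'a set)"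
    and "assoc_algebra.co_corner_ideal scale e = (UNIV :: 'a set)"
  shows "assoc_algebra.fg_lie_algebra scale (assoc_algebra.commutator_space scale)"
proof -
  interpret assoc_algebra scale by fact
  from assms(3) peirce_generate [OF assms(4-6)] obtain Z
    where Z: "finite Z" "Z \<subseteq> peirce10 e \<union> peirce01 e" "subalgebra (*) hull Z = UNIV"
    by (rule finitely_generated_finite_subset)
  \<comment> \<open>Splitting \<open>Z\<close> by Peirce component makes the letters within each
    part annihilate each other.\<close>
  define A where "A = Z \<inter> peirce10 e"
  define B where "B = Z \<inter> peirce01 e"
  have fin: "finite A" "finite B" and gen: "subalgebra (*) hull (A \<union> B) = UNIV"
    using Z by (auto simp: A_def B_def Int_Un_distrib [symmetric] Int_absorb2)
  have zero: "\<And>a a'. a \<in> A \<Longrightarrow> a' \<in> A \<Longrightarrow> a * a' = 0" "\<And>b b'. b \<in> B \<Longrightarrow> b' \<in> B \<Longrightarrow> b * b' = 0"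
    using peirce10_mult_eq_0 peirce01_mult_eq_0 by (auto simp: A_def B_def)
  define X where "X = (\<Union>n\<le>card A * card B.
    {w. alternating_word A B n w} \<union> {w. alternating_word B A n w})"
  define L where "L = subalgebra lie_bracket hull X"
  have L: "subalgebra lie_bracket L" unfolding L_def by (rule subalgebra_hull)
  have finX: "finite X" unfolding X_def using fin by (auto intro: finite_alternating_words)
  have XC: "X \<subseteq> commutator_space"
    using peirce_subset_commutator_space [of e] alternating_word_peirce10 [of A B _ _ e]
      alternating_word_peirce01 [of B A _ _ e]
    by (auto simp: X_def A_def B_def)
  have short: "w \<in> L" if "n \<le> card A * card B" "alternating_word A B n w \<or> alternating_word B A n w"
    for n w
    unfolding L_def by (rule hull_inc) (use that in \<open>auto simp: X_def\<close>)
  have "commutator_space \<subseteq> L"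
    by (rule commutator_space_subset_alternating [OF L gen zero
          alternating_words_mem [OF assms(1) L fin zero short]])
  moreover have "L \<subseteq> commutator_space"
    unfolding L_def by (intro hull_minimal XC subalgebra_commutator_space)
  ultimately show ?thesis
    using finX XC unfolding finitely_generated_def L_def by blast
qed

end
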